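(* Assume $\mathcal Q_\Lambda^{\mathrm{cl}}\neq\{0\}$ and that the clean detector is gauge compatible: for all $d\in\mathcal K_\Lambda^{\mathrm{cl}}$ and $\gamma\in\Gamma_\Lambda^{\mathrm{cl}}$, $$O_\Lambda^{\mathrm{cl}}(d+\gamma)=O_\Lambda^{\mathrm{cl}}d,\quad \operatorname{Rep}_\Lambda^{\mathrm{cl}}(d+\gamma)=\operatorname{Rep}_\Lambda^{\mathrm{cl}}(d),\quad \operatorname{Tax}_\Lambda^{\mathrm{cl}}(d+\gamma)=\operatorname{Tax}_\Lambda^{\mathrm{cl}}(d).$$ Then the following are equivalent. (i) $\mu_\Lambda^{\mathrm{comp}}>0$. (ii) (Kernel-free condition) For every $d\in\mathcal K_\Lambda^{\mathrm{cl}}$: if $O_\Lambda^{\mathrm{cl}}d=0$, $\operatorname{Rep}_\Lambda^{\mathrm{cl}}(d)=0$ and $\operatorname{Tax}_\Lambda^{\mathrm{cl}}(d)=0$, then $d\in\Gamma_\Lambda^{\mathrm{cl}}$.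
   Context: Let $\Lambda=\{k_0,k_0+1,\dots,k_0+L\}$ be a finite set of consecutive integers and $\Lambda_{\mathrm{adj}}=\{k\in\Lambda: k+1\in\Lambda\}$. For $k\in\Lambda$ let $\mathcal D_k^{\mathrm{cl}}$ be a finite-dimensional real normed space with norm $\|\cdot\|_{\mathrm{cl},k}$; let $\mathcal D_\Lambda^{\mathrm{cl}}=\prod_{k\in\Lambda}\mathcal D_k^{\mathrm{cl}}$ carry a fixed norm $\|\cdot\|_{\mathrm{cl}}$, and let $\mathcal K_\Lambda^{\mathrm{cl}}\subset\mathcal D_\Lambda^{\mathrm{cl}}$ be a linear subspace. Let $G_\Lambda^{\mathrm{cl}}:\mathcal C_\Lambda^{\mathrm{cl}}\to\mathcal D_\Lambda^{\mathrm{cl}}$ be a linear map from a finite-dimensional real normed space, and $\Gamma_\Lambda^{\mathrm{cl}}=\mathcal K_\Lambda^{\mathrm{cl}}\cap\operatorname{Im}G_\Lambda^{\mathrm{cl}}$. For $d\in\mathcal K_\Lambda^{\mathrm{cl}}$ put $\operatorname{dist}_{\mathrm{cl}}(d,\Gamma_\Lambda^{\mathrm{cl}})=\inf_{\gamma\in\Gamma_\Lambda^{\mathrm{cl}}}\|d-\gamma\|_{\mathrm{cl}}$; this is the quotient norm of $[d]$ in $\mathcal Q_\Lambda^{\mathrm{cl}}=\mathcal K_\Lambda^{\mathrm{cl}}/\Gamma_\Lambda^{\mathrm{cl}}$, and $S_\Lambda^{\mathrm{cl}}$ denotes the unit sphere of $\mathcal Q_\Lambda^{\mathrm{cl}}$.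 Observation: $O_\Lambda^{\mathrm{cl}}=(O_\Lambda^P,O_\Lambda^F,O_\Lambda^E,O_\Lambda^T):\mathcal K_\Lambda^{\mathrm{cl}}\to\mathcal Y_\Lambda^P\times\mathcal Y_\Lambda^F\times\mathcal Y_\Lambda^E\times\mathcal Y_\Lambda^T$ is linear, into a product (with a fixed norm) of finite-dimensional normed spaces. Reproduction: for fixed linear maps $R_k^{\mathrm{cl}}:\mathcal D_k^{\mathrm{cl}}\to\mathcal D_{k+1}^{\mathrm{cl}}$ ($k\in\Lambda_{\mathrm{adj}}$), $\operatorname{Rep}_\Lambda^{\mathrm{cl}}(d)=\big(\sum_{k\in\Lambda_{\mathrm{adj}}}\|d_{k+1}-R_k^{\mathrm{cl}}d_k\|_{\mathrm{cl},k+1}^2\big)^{1/2}$. Tax: $\operatorname{Tax}_\Lambda^{\mathrm{cl}}:\mathcal K_\Lambda^{\mathrm{cl}}\to[0,\infty)$ is continuous with $\operatorname{Tax}_\Lambda^{\mathrm{cl}}(\lambda d)=|\lambda|\operatorname{Tax}_\Lambda^{\mathrm{cl}}(d)$ for $\lambda\in\mathbb R$. For fixed $C_R,C_T>0$ put $\mathcal M_\Lambda^{\mathrm{comp}}(d)=\|O_\Lambda^{\mathrm{cl}}d\|+C_R\operatorname{Rep}_\Lambda^{\mathrm{cl}}(d)+C_T\operatorname{Tax}_\Lambda^{\mathrm{cl}}(d)$. Under gauge compatibility $\mathcal M_\Lambda^{\mathrm{comp}}$ descends to $\overline{\mathcal M}_\Lambda^{\mathrm{comp}}([d])=\mathcal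 M_\Lambda^{\mathrm{comp}}(d)$ on $\mathcal Q_\Lambda^{\mathrm{cl}}$, and $\mu_\Lambda^{\mathrm{comp}}:=\inf_{q\in S_\Lambda^{\mathrm{cl}}}\overline{\mathcal M}_\Lambda^{\mathrm{comp}}(q)$. *)

theory Defs
  imports "HOL-Analysis.Analysis" "HOL-Library.Function_Algebras"
begin

text \<open>Pointwise scalar multiplication, so that \<^typ>\<open>int \<Rightarrow> 'd\<close> is a real vector space.\<close>

instantiation "fun" :: (type, real_vector) real_vector
begin

definition scaleR_fun :: "real \<Rightarrow> ('a \<Rightarrow> 'b) \<Rightarrow> 'a \<Rightarrow> 'b"
  where "scaleR_fun c f = (\<lambda>x. c *\<^sub>R f x)"

instance
  by standard (auto simp: scaleR_fun_def fun_eq_iff scaleR_add_right scaleR_add_left)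

end

definition fin_dim :: "'a::real_vector set \<Rightarrow> bool"
  where "fin_dim V \<longleftrightarrow> (\<exists>B. finite B \<and> span B = V)"

definition norm_on :: "'a::real_vector set \<Rightarrow> ('a \<Rightarrow> real) \<Rightarrow> bool"
  where "norm_on V N \<longleftrightarrow>
    (\<forall>x\<in>V. 0 \<le> N x \<and> (N x = 0 \<longleftrightarrow> x = 0)) \<and>
    (\<forall>c. \<forall>x\<in>V. N (c *\<^sub>R x) = \<bar>c\<bar> * N x) \<and>
    (\<forall>x\<in>V. \<forall>y\<in>V. N (x + y) \<le> N x + N y)"

definition linear_between ::
    "'a::real_vector set \<Rightarrow> 'b::real_vector set \<Rightarrow> ('a \<Rightarrow> 'b) \<Rightarrow> bool"
  where "linear_between V W f \<longleftrightarrow>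
    f ` V \<subseteq> W \<and>
    (\<forall>x\<in>V. \<forall>y\<in>V. f (x + y) = f x + f y) \<and>
    (\<forall>c. \<forall>x\<in>V. f (c *\<^sub>R x) = c *\<^sub>R f x)"

text \<open>
  The metric of a norm given on a carrier. The default value 0 only matters for points that
  do not both lie in the carrier; it is there because \<^locale>\<open>Metric_space\<close> asks for
  nonnegativity and symmetry on the whole type.
\<close>

definition norm_dist :: "'a::real_vector set \<Rightarrow> ('a \<Rightarrow> real) \<Rightarrow> 'a \<Rightarrow> 'a \<Rightarrow> real"
  where "norm_dist V N x y = (if x - y \<in> V then N (x - y) else 0)"

lemma Metric_space_norm_dist:
  assumes V: "subspace V" and N: "norm_on V N"
  shows "Metric_space V (norm_dist V N)"
proof
  fix x y
  show "0 \<le> norm_dist V N x y"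
    using N by (auto simp: norm_dist_def norm_on_def)
  have "x - y \<in> V \<longleftrightarrow> y - x \<in> V"
    using subspace_neg[OF V] by (metis minus_diff_eq)
  moreover have "N (x - y) = N (y - x)" if "x - y \<in> V"
  proof -
    have "N ((- 1) *\<^sub>R (x - y)) = \<bar>- 1\<bar> * N (x - y)"
      using N that unfolding norm_on_def by blast
    then show ?thesis by simp
  qed
  ultimately show "norm_dist V N x y = norm_dist V N y x"
    by (auto simp: norm_dist_def)
next
  fix x y assume "x \<in> V" "y \<in> V"
  then show "norm_dist V N x y = 0 \<longleftrightarrow> x = y"
    using N subspace_diff[OF V] by (auto simp: norm_dist_def norm_on_def)
next
  fix x y z assume xyz: "x \<in> V" "y \<in> V" "z \<in> V"
  then have "x - y \<in> V" "y - z \<in> V" "x - z \<in> V"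
    using subspace_diff[OF V] by auto
  moreover from this have "N ((x - y) + (y - z)) \<le> N (x - y) + N (y - z)"
    using N unfolding norm_on_def by blast
  ultimately show "norm_dist V N x z \<le> norm_dist V N x y + norm_dist V N y z"
    by (simp add: norm_dist_def)
qed

definition adj :: "int set \<Rightarrow> int set"
  where "adj \<Lambda> = {k \<in> \<Lambda>. k + 1 \<in> \<Lambda>}"

text \<open>The product of the \<open>D k\<close>, \<open>k \<in> \<Lambda>\<close>: families are normalised to 0 outside \<open>\<Lambda>\<close>.\<close>

definition prod_space :: "int set \<Rightarrow> (int \<Rightarrow> 'd::real_vector set) \<Rightarrow> (int \<Rightarrow> 'd) set"
  where "prod_space \<Lambda> D = {d. (\<forall>k\<in>\<Lambda>. d k \<in> D k) \<and> (\<forall>k. k \<notin> \<Lambda> \<longrightarrow> d k = 0)}"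

definition dist_to :: "('a::real_vector \<Rightarrow> real) \<Rightarrow> 'a set \<Rightarrow> 'a \<Rightarrow> real"
  where "dist_to N \<Gamma> d = (INF \<gamma>\<in>\<Gamma>. N (d - \<gamma>))"

definition coset :: "'a::real_vector set \<Rightarrow> 'a \<Rightarrow> 'a set"
  where "coset \<Gamma> d = (\<lambda>\<gamma>. d + \<gamma>) ` \<Gamma>"

definition quotient_space :: "'a::real_vector set \<Rightarrow> 'a set \<Rightarrow> 'a set set"
  where "quotient_space K \<Gamma> = coset \<Gamma> ` K"

text \<open>
  \<open>descend f q\<close> is the common value of \<open>f\<close> on the class \<open>q\<close>; it is meaningful only if \<open>f\<close>
  is constant on \<open>q\<close>.
\<close>

definition descend :: "('a \<Rightarrow> 'b) \<Rightarrow> 'a set \<Rightarrow> 'b"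
  where "descend f q = the_elem (f ` q)"

lemma descend_coset:
  assumes "subspace \<Gamma>" "\<And>\<gamma>. \<gamma> \<in> \<Gamma> \<Longrightarrow> f (d + \<gamma>) = f d"
  shows "descend f (coset \<Gamma> d) = f d"
proof -
  have "f ` coset \<Gamma> d = {f d}"
    using assms subspace_0[OF assms(1)] by (force simp: coset_def)
  then show ?thesis by (simp add: descend_def)
qed

definition quot_norm :: "('a::real_vector \<Rightarrow> real) \<Rightarrow> 'a set \<Rightarrow> 'a set \<Rightarrow> real"
  where "quot_norm N \<Gamma> q = descend (dist_to N \<Gamma>) q"

definition quot_sphere :: "('a::real_vector \<Rightarrow> real) \<Rightarrow> 'a set \<Rightarrow> 'a set \<Rightarrow> 'a set set"
  where "quot_sphere N K \<Gamma> = {q \<in> quotient_space K \<Gamma>. quot_norm N \<Gamma> q = 1}"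

definition Obs :: "('a \<Rightarrow> 'p) \<Rightarrow> ('a \<Rightarrow> 'f) \<Rightarrow> ('a \<Rightarrow> 'e) \<Rightarrow> ('a \<Rightarrow> 't) \<Rightarrow> 'a \<Rightarrow> 'p \<times> 'f \<times> 'e \<times> 't"
  where "Obs OP OF OE OT d = (OP d, OF d, OE d, OT d)"

definition Rep ::
    "int set \<Rightarrow> (int \<Rightarrow> 'd \<Rightarrow> real) \<Rightarrow> (int \<Rightarrow> 'd \<Rightarrow> 'd) \<Rightarrow> (int \<Rightarrow> 'd::real_vector) \<Rightarrow> real"
  where "Rep \<Lambda> ND R d = sqrt (\<Sum>k\<in>adj \<Lambda>. (ND (k + 1) (d (k + 1) - R k (d k)))\<^sup>2)"

definition comp_detector ::
    "('y \<Rightarrow> real) \<Rightarrow> real \<Rightarrow> real \<Rightarrow> ('a \<Rightarrow> 'y) \<Rightarrow> ('a \<Rightarrow> real) \<Rightarrow> ('a \<Rightarrow> real) \<Rightarrow> 'a \<Rightarrow> real"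
  where "comp_detector NY CR CT obs rep tax d = NY (obs d) + CR * rep d + CT * tax d"

definition comp_margin ::
    "('a::real_vector \<Rightarrow> real) \<Rightarrow> 'a set \<Rightarrow> 'a set \<Rightarrow> ('a \<Rightarrow> real) \<Rightarrow> real"
  where "comp_margin N K \<Gamma> M = (INF q\<in>quot_sphere N K \<Gamma>. descend M q)"

end

theory Submission
  imports Defs
begin

text \<open>
  The detector splits as a seminorm (observation plus reproduction) and a multiple of the tax, so
  it is continuous, homogeneous and gauge invariant. If the margin were 0 while the kernel is
  trivial, a minimising sequence of representatives on the quotient sphere, shifted by elements
  of \<open>\<Gamma>\<close> to have norm below 2, would have a limit point \<open>l\<close> where the detector vanishes; then
  \<open>l \<in> \<Gamma>\<close>, contradicting that the sequence stays at distance 1 from \<open>\<Gamma>\<close>. Conversely a kernel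
  element outside \<open>\<Gamma>\<close> has positive distance to \<open>\<Gamma>\<close> and normalises to a point of the sphere where
  the detector is 0. Compactness and equivalence of seminorms are obtained by induction on a
  spanning set: a vector outside a subspace satisfying Bolzano-Weierstrass has positive distance
  to it, and this gap controls the coefficient of the new vector.
\<close>

subsection \<open>Norms on finite-dimensional subspaces\<close>

lemma norm_on_D:
  assumes "norm_on V N" "x \<in> V"
  shows norm_on_nonneg: "0 \<le> N x" and norm_on_eq_0: "N x = 0 \<longleftrightarrow> x = 0"
    and norm_on_scaleR: "N (c *\<^sub>R x) = \<bar>c\<bar> * N x"
  using assms by (auto simp: norm_on_def)

lemma norm_on_triangle:
  "norm_on V N \<Longrightarrow> x \<in> V \<Longrightarrow> y \<in> V \<Longrightarrow> N (x + y) \<le> N x + N y"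
  by (auto simp: norm_on_def)

lemma norm_on_subset: "norm_on V N \<Longrightarrow> W \<subseteq> V \<Longrightarrow> norm_on W N"
  by (simp add: norm_on_def subset_iff)

lemma norm_on_minus:
  assumes "norm_on V N" "x \<in> V"
  shows "N (- x) = N x"
  using norm_on_scaleR[OF assms, of "-1"] by simp

lemma norm_on_minus_commute:
  assumes "norm_on V N" "subspace V" "x \<in> V" "y \<in> V"
  shows "N (x - y) = N (y - x)"
  using norm_on_minus[OF assms(1) subspace_diff[OF assms(2-4)]] by simp

lemma norm_on_diff_triangle:
  assumes "norm_on V N" "subspace V" "x \<in> V" "y \<in> V" "z \<in> V"
  shows "N (x - z) \<le> N (x - y) + N (y - z)"
  using norm_on_triangle[OF assms(1), of "x - y" "y - z"] assms by (simp add: subspace_diff)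

section \<open>Sequential compactness in finite dimension\<close>

text \<open>Phrased with sequences and the carrier norm \<open>N\<close>, so that it applies to a
  norm given on a subspace rather than on a type. Demanding the limit in \<open>V\<close> also makes
  \<open>V\<close> closed in every larger space normed by \<open>N\<close>.\<close>

definition bolzano_weierstrass_on :: "'a::real_vector set \<Rightarrow> ('a \<Rightarrow> real) \<Rightarrow> bool"
  where "bolzano_weierstrass_on V N \<longleftrightarrow>
    (\<forall>C x. (\<forall>n::nat. x n \<in> V \<and> N (x n) \<le> C) \<longrightarrow>
      (\<exists>l\<in>V. \<exists>r. strict_mono r \<and> (\<lambda>n. N (x (r n) - l)) \<longlonglongrightarrow> 0))"

lemma bolzano_weierstrass_onE:
  assumes "bolzano_weierstrass_on V N" "\<And>n::nat. x n \<in> V" "\<And>n. N (x n) \<le> C"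
  obtains l r where "l \<in> V" "strict_mono r" "(\<lambda>n. N (x (r n) - l)) \<longlonglongrightarrow> 0"
  using assms unfolding bolzano_weierstrass_on_def by meson

text \<open>Points of \<open>W\<close> coming arbitrarily close to \<open>b\<close> form a bounded
  sequence; a limit point lies in \<open>W\<close> and has distance 0 from \<open>b\<close>, so it
  would be \<open>b\<close> itself.\<close>

lemma bolzano_weierstrass_on_gap:
  assumes bw: "bolzano_weierstrass_on W N" and N: "norm_on V N" and V: "subspace V"
    and W: "W \<subseteq> V" and b: "b \<in> V" "b \<notin> W"
  obtains \<delta> where "0 < \<delta>" "\<forall>y\<in>W. \<delta> \<le> N (b - y)"
proof -
  have "\<exists>\<delta>>0. \<forall>y\<in>W. \<delta> \<le> N (b - y)"
  proof (rule ccontr)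
    assume "\<not> (\<exists>\<delta>>0. \<forall>y\<in>W. \<delta> \<le> N (b - y))"
    then have ex: "\<exists>y\<in>W. N (b - y) < \<delta>" if "0 < \<delta>" for \<delta>
      using that by (meson not_le)
    have "\<forall>n. \<exists>y\<in>W. N (b - y) < 1 / real (Suc n)"
      by (intro allI ex) simp
    then obtain y where y: "\<And>n. y n \<in> W" "\<And>n. N (b - y n) < 1 / real (Suc n)"
      by metis
    have yV: "y n \<in> V" for n using y W by blast
    have bound: "N (y n) \<le> N b + 1" for n
    proof -
      have "N (y n) \<le> N (y n - b) + N b"
        using norm_on_diff_triangle[OF N V yV b(1) subspace_0[OF V], of n] by simp
      also have "N (y n - b) = N (b - y n)"
        by (rule norm_on_minus_commute[OF N V yV b(1)])
      also have "N (b - y n) \<le> 1"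
        using y(2)[of n] by (rule order.trans[OF less_imp_le]) simp
      finally show ?thesis by simp
    qed
    obtain l r where l: "l \<in> W" and r: "strict_mono r" and lim: "(\<lambda>n. N (y (r n) - l)) \<longlonglongrightarrow> 0"
      by (rule bolzano_weierstrass_onE[where x = y, OF bw y(1) bound])
    have lV: "l \<in> V" using l W by blast
    have "(\<lambda>n. 1 / real (Suc (r n))) \<longlonglongrightarrow> 0"
      using LIMSEQ_subseq_LIMSEQ[OF lim_1_over_n[THEN LIMSEQ_Suc] r] by (simp add: o_def)
    from tendsto_add[OF this lim]
    have "(\<lambda>n. 1 / real (Suc (r n)) + N (y (r n) - l)) \<longlonglongrightarrow> 0" by simp
    moreover have "N (b - l) \<le> 1 / real (Suc (r n)) + N (y (r n) - l)" for n
      using norm_on_diff_triangle[OF N V b(1) yV lV, of "r n"] y(2)[of "r n"] by linarith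
    ultimately have "N (b - l) \<le> 0"
      by (intro LIMSEQ_le_const) auto
    then have "b = l"
      using norm_on_D[OF N subspace_diff[OF V b(1) lV]] by simp
    with l b show False by simp
  qed
  then show ?thesis using that by blast
qed

text \<open>Pulling \<open>c\<close> out of \<open>c *\<^sub>R b + y\<close> leaves the difference
  of \<open>b\<close> and a point of \<open>W\<close>, to which the gap applies. For positive
  \<open>\<delta>\<close> the coefficient of \<open>b\<close> is thus controlled by the norm of the
  whole vector.\<close>

lemma norm_on_coefficient_bound:
  assumes N: "norm_on V N" and V: "subspace V" and W: "subspace W" "W \<subseteq> V"
    and b: "b \<in> V" and gap: "\<forall>y\<in>W. \<delta> \<le> N (b - y)" and y: "y \<in> W"
  shows "\<bar>c\<bar> * \<delta> \<le> N (c *\<^sub>R b + y)"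
proof (cases "c = 0")
  case True
  then show ?thesis using norm_on_nonneg[OF N] y W by auto
next
  case False
  have y': "(- 1 / c) *\<^sub>R y \<in> W" by (rule subspace_scale[OF W(1) y])
  then have "b - (- 1 / c) *\<^sub>R y \<in> V" using W(2) by (intro subspace_diff[OF V b]) auto
  from norm_on_scaleR[OF N this, of c]
  have "N (c *\<^sub>R b + y) = \<bar>c\<bar> * N (b - (- 1 / c) *\<^sub>R y)"
    using False by (simp add: algebra_simps)
  with mult_left_mono[OF bspec[OF gap y'], of "\<bar>c\<bar>"] show ?thesis by simp
qed

lemma span_insertE:
  assumes "x \<in> span (insert b B)"
  obtains c y where "y \<in> span B" "x = c *\<^sub>R b + y"
  using assms span_breakdown_eq[of x b B] by (metis add.commute diff_add_cancel)

text \<open>Adding one spanning vector \<open>b\<close> adds one real coefficient. The coefficients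
  are bounded by the gap and converge along a subsequence; the remainders in the smaller span are
  then bounded too, and the induction hypothesis refines the subsequence.\<close>

lemma bolzano_weierstrass_on_span:
  assumes "finite B" "norm_on (span B) N"
  shows "bolzano_weierstrass_on (span B) N"
  using assms
proof (induction B)
  case empty
  have "N 0 = 0" using norm_on_eq_0[OF empty, of 0] by simp
  moreover have "strict_mono (\<lambda>n::nat. n)" by (simp add: strict_mono_def)
  ultimately show ?case
    unfolding bolzano_weierstrass_on_def by (intro allI impI bexI[of _ 0] exI[of _ "\<lambda>n. n"]) auto
next
  case (insert b B)
  let ?V = "span (insert b B)" and ?W = "span B"
  have W: "?W \<subseteq> ?V" by (simp add: span_mono subset_insertI)
  have bV: "b \<in> ?V" by (simp add: span_base)
  note N = insert.prems
  have bw: "bolzano_weierstrass_on ?W N"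
    using insert.IH norm_on_subset[OF N W] by blast
  show ?case
  proof (cases "b \<in> ?W")
    \<comment> \<open>The spanning set may be dependent, so the new vector may leave the span
      unchanged.\<close>
    case True
    then show ?thesis using bw by (simp add: span_redundant)
  next
    case False
    obtain \<delta> where \<delta>: "0 < \<delta>" "\<forall>y\<in>?W. \<delta> \<le> N (b - y)"
      using bolzano_weierstrass_on_gap[OF bw N subspace_span W bV False] by blast
    note coeff = norm_on_coefficient_bound[OF N subspace_span subspace_span W bV \<delta>(2)]
    show ?thesis
      unfolding bolzano_weierstrass_on_def
    proof (intro allI impI)
      fix C x assume x: "\<forall>n::nat. x n \<in> ?V \<and> N (x n) \<le> C"
      have "\<forall>n. \<exists>c y. y \<in> ?W \<and> x n = c *\<^sub>R b + y"
        using x span_insertE by metis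
      then obtain c y where y: "\<And>n. y n \<in> ?W" and xcy: "\<And>n. x n = c n *\<^sub>R b + y n"
        by metis
      have c: "\<bar>c n\<bar> \<le> C / \<delta>" for n
      proof -
        have "\<bar>c n\<bar> * \<delta> \<le> N (x n)" using coeff[OF y, of "c n" n] by (simp only: xcy)
        also have "\<dots> \<le> C" using x by blast
        finally show ?thesis using \<delta>(1) by (simp add: pos_le_divide_eq)
      qed
      then have "bounded (range c)" by (auto simp: bounded_iff)
      then obtain c0 r1 where r1: "strict_mono r1" and c0: "(c \<circ> r1) \<longlonglongrightarrow> c0"
        using bounded_imp_convergent_subsequence by blast
      \<comment> \<open>The remainder is \<open>x n\<close> minus a multiple of \<open>b\<close>
        whose coefficient is already bounded.\<close>
      have ybound: "N (y n) \<le> C + C / \<delta> * N b" for n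
      proof -
        have "N (y n) = N (x n + (- c n) *\<^sub>R b)" by (simp add: xcy)
        also have "\<dots> \<le> N (x n) + N ((- c n) *\<^sub>R b)"
          using x bV by (intro norm_on_triangle[OF N] subspace_scale) auto
        also have "N ((- c n) *\<^sub>R b) = \<bar>c n\<bar> * N b"
          using norm_on_scaleR[OF N bV, of "- c n"] by simp
        also have "\<dots> \<le> C / \<delta> * N b"
          by (intro mult_right_mono c norm_on_nonneg[OF N bV])
        finally have "N (y n) \<le> N (x n) + C / \<delta> * N b" by simp
        moreover have "N (x n) \<le> C" using x by blast
        ultimately show ?thesis by simp
      qed
      obtain l r2 where l: "l \<in> ?W" and r2: "strict_mono r2"
        and lim: "(\<lambda>n. N (y (r1 (r2 n)) - l)) \<longlonglongrightarrow> 0"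
        by (rule bolzano_weierstrass_onE[where x = "\<lambda>n. y (r1 n)", OF bw y ybound])
      have sub: "strict_mono (r1 \<circ> r2)" using r1 r2 by (rule strict_mono_o)
      have "(\<lambda>n. c (r1 (r2 n))) \<longlonglongrightarrow> c0"
        using LIMSEQ_subseq_LIMSEQ[OF c0 r2] by (simp add: o_def)
      \<comment> \<open>This null sequence is the upper bound in the sandwich below; the rotated
        rule takes its limit as first premise.\<close>
      then have "(\<lambda>n. \<bar>c (r1 (r2 n)) - c0\<bar> * N b + N (y (r1 (r2 n)) - l)) \<longlonglongrightarrow> 0"
        using lim by (auto intro!: tendsto_eq_intros)
      then have "(\<lambda>n. N (x ((r1 \<circ> r2) n) - (c0 *\<^sub>R b + l))) \<longlonglongrightarrow> 0"
      proof (rule real_tendsto_sandwich[OF _ _ tendsto_const, rotated 2])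
        have V: "x n \<in> ?V" "y n - l \<in> ?V" "c0 *\<^sub>R b + l \<in> ?V" for n
          using x y l W bV by (auto intro!: subspace_add subspace_scale subspace_diff)
        show "\<forall>\<^sub>F n in sequentially. 0 \<le> N (x ((r1 \<circ> r2) n) - (c0 *\<^sub>R b + l))"
          using V by (intro always_eventually allI norm_on_nonneg[OF N] subspace_diff) auto
        have "N (x n - (c0 *\<^sub>R b + l)) \<le> \<bar>c n - c0\<bar> * N b + N (y n - l)" for n
        proof -
          have "x n - (c0 *\<^sub>R b + l) = (c n - c0) *\<^sub>R b + (y n - l)"
            by (simp add: xcy algebra_simps)
          then show ?thesis
            using norm_on_triangle[OF N subspace_scale[OF subspace_span bV] V(2), of "c n - c0" n]
              norm_on_scaleR[OF N bV] by metis
        qed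
        then show "\<forall>\<^sub>F n in sequentially. N (x ((r1 \<circ> r2) n) - (c0 *\<^sub>R b + l))
            \<le> \<bar>c (r1 (r2 n)) - c0\<bar> * N b + N (y (r1 (r2 n)) - l)"
          by simp
      qed
      moreover have "c0 *\<^sub>R b + l \<in> ?V"
        using l W bV by (auto intro!: subspace_add subspace_scale)
      ultimately show "\<exists>l\<in>?V. \<exists>r. strict_mono r \<and> (\<lambda>n. N (x (r n) - l)) \<longlonglongrightarrow> 0"
        using sub by (intro bexI[of _ "c0 *\<^sub>R b + l"] exI[of _ "r1 \<circ> r2"] conjI)
    qed
  qed
qed

section \<open>Domination of seminorms by norms\<close>

definition seminorm_on :: "'a::real_vector set \<Rightarrow> ('a \<Rightarrow> real) \<Rightarrow> bool"
  where "seminorm_on V p \<longleftrightarrow>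
    (\<forall>x\<in>V. 0 \<le> p x) \<and> (\<forall>c. \<forall>x\<in>V. p (c *\<^sub>R x) = \<bar>c\<bar> * p x) \<and>
    (\<forall>x\<in>V. \<forall>y\<in>V. p (x + y) \<le> p x + p y)"

lemma seminorm_on_subset: "seminorm_on V p \<Longrightarrow> W \<subseteq> V \<Longrightarrow> seminorm_on W p"
  by (simp add: seminorm_on_def subset_iff)

text \<open>The norm controls both parts of \<open>c *\<^sub>R b + y\<close>: the coefficient
  through the gap, and hence the remainder, where the induction hypothesis bounds \<open>p\<close>.
  This makes every seminorm continuous for \<open>N\<close>.\<close>

lemma seminorm_on_span_bound:
  assumes "finite B" "norm_on (span B) N" "seminorm_on (span B) p"
  shows "\<exists>C\<ge>0. \<forall>x\<in>span B. p x \<le> C * N x"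
  using assms
proof (induction B)
  case empty
  have "p (0 *\<^sub>R 0) = \<bar>0\<bar> * p 0" using empty(2) unfolding seminorm_on_def span_empty by blast
  moreover have "N 0 = 0" using norm_on_eq_0[OF empty(1)] by simp
  ultimately show ?case by (intro exI[of _ 0]) simp
next
  case (insert b B)
  let ?V = "span (insert b B)" and ?W = "span B"
  have W: "?W \<subseteq> ?V" by (simp add: span_mono subset_insertI)
  have bV: "b \<in> ?V" by (simp add: span_base)
  note N = insert.prems(1) and p = insert.prems(2)
  have NW: "norm_on ?W N" by (rule norm_on_subset[OF N W])
  have "seminorm_on ?W p" by (rule seminorm_on_subset[OF p W])
  then obtain C where C: "C \<ge> 0" "\<And>x. x \<in> ?W \<Longrightarrow> p x \<le> C * N x"
    using insert.IH NW by blast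
  show ?case
  proof (cases "b \<in> ?W")
    case True
    show ?thesis
      unfolding span_redundant[OF True] by (intro exI[of _ C] conjI ballI C)
  next
    case False
    obtain \<delta> where \<delta>: "0 < \<delta>" "\<forall>y\<in>?W. \<delta> \<le> N (b - y)"
      using bolzano_weierstrass_on_gap[OF bolzano_weierstrass_on_span[OF insert.hyps(1) NW]
          N subspace_span W bV False] by blast
    \<comment> \<open>Obtained by inserting \<open>\<bar>c\<bar> \<le> N x / \<delta>\<close> and
      \<open>N y \<le> N x + \<bar>c\<bar> * N b\<close> into
      \<open>p x \<le> \<bar>c\<bar> * p b + C * N y\<close>.\<close>
    define C' where "C' = (p b + C * N b) / \<delta> + C"
    have pb: "0 \<le> p b" using p bV by (auto simp: seminorm_on_def)
    have Nb: "0 \<le> N b" by (rule norm_on_nonneg[OF N bV])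
    have "p x \<le> C' * N x" if x: "x \<in> ?V" for x
    proof -
      obtain c y where y: "y \<in> ?W" and xcy: "x = c *\<^sub>R b + y"
        using span_insertE[OF x] by blast
      have cb: "c' *\<^sub>R b \<in> ?V" for c' using bV by (auto intro!: subspace_scale)
      have "p x \<le> \<bar>c\<bar> * p b + p y"
        using p bV cb[of c] y W unfolding seminorm_on_def xcy by (metis subsetD)
      also have "\<bar>c\<bar> * p b + p y \<le> \<bar>c\<bar> * p b + C * N y"
        by (rule add_left_mono[OF C(2)[OF y]])
      also have "\<dots> \<le> \<bar>c\<bar> * p b + C * (N x + \<bar>c\<bar> * N b)"
      proof (rule add_left_mono[OF mult_left_mono[OF _ C(1)]])
        show "N y \<le> N x + \<bar>c\<bar> * N b"
          using norm_on_triangle[OF N x cb[of "- c"]] norm_on_scaleR[OF N bV, of "- c"]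
          by (simp add: xcy)
      qed
      also have "\<dots> = \<bar>c\<bar> * (p b + C * N b) + C * N x"
        by (simp add: algebra_simps)
      also have "\<dots> \<le> N x / \<delta> * (p b + C * N b) + C * N x"
      proof (rule add_right_mono[OF mult_right_mono])
        show "\<bar>c\<bar> \<le> N x / \<delta>"
          using norm_on_coefficient_bound[OF N subspace_span subspace_span W bV \<delta>(2) y, of c] \<delta>(1)
          by (simp add: xcy pos_le_divide_eq)
      qed (use pb Nb C(1) in simp)
      also have "\<dots> = C' * N x"
        using \<delta>(1) by (simp add: C'_def field_simps)
      finally show ?thesis .
    qed
    moreover have "0 \<le> C'" using pb Nb C(1) \<delta>(1) by (simp add: C'_def)
    ultimately show ?thesis by (intro exI[of _ C'] conjI ballI)
  qed
qed

section \<open>Finite dimension of subspaces and products\<close>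

text \<open>A maximal independent subset of \<open>K\<close> spans \<open>K\<close>, and
  independence inside the span of a finite set forces it to be finite.\<close>

lemma subspace_fin_dim_mono:
  assumes "fin_dim V" "subspace K" "K \<subseteq> V"
  shows "fin_dim K"
proof -
  obtain T where T: "finite T" "span T = V" using assms(1) by (auto simp: fin_dim_def)
  obtain B where B: "B \<subseteq> K" "independent B" "K \<subseteq> span B"
    using maximal_independent_subset by blast
  have "finite B"
    using independent_span_bound[OF T(1) B(2)] B(1) assms(3) T(2) by blast
  moreover have "span B = K"
    using span_minimal[OF B(1) assms(2)] B(3) by blast
  ultimately show ?thesis unfolding fin_dim_def by blast
qed

lemma fin_dim_prod_space:
  fixes D :: "int \<Rightarrow> 'd::real_vector set"
  assumes fin: "finite \<Lambda>" and D: "\<And>k. k \<in> \<Lambda> \<Longrightarrow> subspace (D k) \<and> fin_dim (D k)"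
  shows "fin_dim (prod_space \<Lambda> D)"
proof -
  have "\<forall>k\<in>\<Lambda>. \<exists>B. finite B \<and> span B = D k" using D by (simp add: fin_dim_def)
  then obtain B where B: "\<And>k. k \<in> \<Lambda> \<Longrightarrow> finite (B k)" "\<And>k. k \<in> \<Lambda> \<Longrightarrow> span (B k) = D k"
    by metis
  \<comment> \<open>\<open>e k\<close> embeds the factor with index \<open>k\<close>; the images of
    spanning sets of the factors together span the product.\<close>
  define e :: "int \<Rightarrow> 'd \<Rightarrow> int \<Rightarrow> 'd" where "e k v = (\<lambda>j. if j = k then v else 0)" for k v
  have e_linear: "linear (e k)" for k
    by (rule linearI) (auto simp: e_def fun_eq_iff scaleR_fun_def)
  define T where "T = (\<Union>k\<in>\<Lambda>. e k ` B k)"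
  have "span T = prod_space \<Lambda> D"
  proof
    have sub: "subspace (prod_space \<Lambda> D)"
      using D by (auto simp: subspace_def prod_space_def scaleR_fun_def)
    have "B k \<subseteq> D k" if "k \<in> \<Lambda>" for k
      using span_superset[of "B k"] B(2)[OF that] by simp
    then have "T \<subseteq> prod_space \<Lambda> D"
      using D by (fastforce simp: T_def e_def prod_space_def subspace_0)
    then show "span T \<subseteq> prod_space \<Lambda> D" by (rule span_minimal[OF _ sub])
  next
    show "prod_space \<Lambda> D \<subseteq> span T"
    proof
      fix d assume d: "d \<in> prod_space \<Lambda> D"
      \<comment> \<open>For \<open>j\<close> outside \<open>\<Lambda>\<close> both sides are 0,
        because members of the product are normalised to 0 there.\<close>
      have "d j = (\<Sum>k\<in>\<Lambda>. e k (d k)) j" for j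
      proof -
        have "(\<Sum>k\<in>\<Lambda>. e k (d k)) j = (\<Sum>k\<in>\<Lambda>. e k (d k) j)"
          by (induction \<Lambda> rule: infinite_finite_induct) auto
        then show ?thesis using d fin by (simp add: e_def prod_space_def)
      qed
      then have "d = (\<Sum>k\<in>\<Lambda>. e k (d k))" by blast
      moreover have "e k (d k) \<in> span T" if k: "k \<in> \<Lambda>" for k
      proof -
        have "d k \<in> span (B k)" using d k B(2) by (simp add: prod_space_def)
        then have "e k (d k) \<in> span (e k ` B k)"
          using linear_span_image[OF e_linear] by blast
        then show ?thesis using k span_mono[of "e k ` B k" T] by (auto simp: T_def)
      qed
      ultimately show "d \<in> span T" by (metis span_sum)
    qed
  qed
  moreover have "finite T" using fin B(1) by (auto simp: T_def)
  ultimately show ?thesis unfolding fin_dim_def by blast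
qed

subsection \<open>The quotient norm\<close>

text \<open>An infimum of reals lies below its terms once they are bounded below; here 0 is a lower
  bound because all differences stay in \<open>K\<close>.\<close>

lemma dist_to_le:
  assumes "norm_on K N" "subspace K" "\<Gamma> \<subseteq> K" "d \<in> K" "\<gamma> \<in> \<Gamma>"
  shows "dist_to N \<Gamma> d \<le> N (d - \<gamma>)"
  unfolding dist_to_def
proof (rule cINF_lower[OF _ assms(5)])
  show "bdd_below ((\<lambda>\<gamma>. N (d - \<gamma>)) ` \<Gamma>)"
    using assms by (intro bdd_belowI2[of _ 0] norm_on_nonneg[OF assms(1)] subspace_diff) auto
qed

lemma dist_to_ge:
  assumes "subspace \<Gamma>" "\<And>\<gamma>. \<gamma> \<in> \<Gamma> \<Longrightarrow> \<delta> \<le> N (d - \<gamma>)"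
  shows "\<delta> \<le> dist_to N \<Gamma> d"
  unfolding dist_to_def using assms subspace_0[OF assms(1)] by (intro cINF_greatest) auto

text \<open>\<open>\<Gamma>\<close> is closed under scaling, so \<open>c *\<^sub>R \<gamma>\<close>
  competes in the infimum for \<open>c *\<^sub>R d\<close>. Dividing by \<open>\<bar>c\<bar>\<close>
  turns the claim into a lower bound for an infimum.\<close>

lemma dist_to_scaleR_le:
  assumes N: "norm_on K N" and K: "subspace K" and \<Gamma>: "subspace \<Gamma>" "\<Gamma> \<subseteq> K"
    and d: "d \<in> K" and c: "c \<noteq> 0"
  shows "dist_to N \<Gamma> (c *\<^sub>R d) \<le> \<bar>c\<bar> * dist_to N \<Gamma> d"
proof -
  have "dist_to N \<Gamma> (c *\<^sub>R d) / \<bar>c\<bar> \<le> dist_to N \<Gamma> d"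
  proof (rule dist_to_ge[OF \<Gamma>(1)])
    fix \<gamma> assume g: "\<gamma> \<in> \<Gamma>"
    have "dist_to N \<Gamma> (c *\<^sub>R d) \<le> N (c *\<^sub>R d - c *\<^sub>R \<gamma>)"
      by (intro dist_to_le[OF N K \<Gamma>(2)] subspace_scale K \<Gamma>(1) d g)
    also have "\<dots> = \<bar>c\<bar> * N (d - \<gamma>)"
      using norm_on_scaleR[OF N, of "d - \<gamma>" c] subspace_diff[OF K d, of \<gamma>] g \<Gamma>(2)
      by (auto simp: scaleR_diff_right)
    finally show "dist_to N \<Gamma> (c *\<^sub>R d) / \<bar>c\<bar> \<le> N (d - \<gamma>)"
      using c by (simp add: pos_divide_le_eq mult.commute)
  qed
  then show ?thesis using c by (simp add: pos_divide_le_eq mult.commute)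
qed

lemma dist_to_scaleR:
  assumes N: "norm_on K N" and K: "subspace K" and \<Gamma>: "subspace \<Gamma>" "\<Gamma> \<subseteq> K"
    and d: "d \<in> K" and c: "c \<noteq> 0"
  shows "dist_to N \<Gamma> (c *\<^sub>R d) = \<bar>c\<bar> * dist_to N \<Gamma> d"
proof (rule antisym)
  \<comment> \<open>The reverse inequality is the same estimate for the vector
    \<open>c *\<^sub>R d\<close> and the factor \<open>1 / c\<close>.\<close>
  have "dist_to N \<Gamma> ((1 / c) *\<^sub>R (c *\<^sub>R d)) \<le> \<bar>1 / c\<bar> * dist_to N \<Gamma> (c *\<^sub>R d)"
    using dist_to_scaleR_le[OF N K \<Gamma> subspace_scale[OF K d, of c], of "1 / c"] c by simp
  then show "\<bar>c\<bar> * dist_to N \<Gamma> d \<le> dist_to N \<Gamma> (c *\<^sub>R d)"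
    using c by (simp add: field_simps)
qed (rule dist_to_scaleR_le[OF assms])

text \<open>Translation by \<open>\<gamma>\<close> permutes \<open>\<Gamma>\<close>, so both infima
  run over the same set of values.\<close>

lemma dist_to_add:
  assumes \<Gamma>: "subspace \<Gamma>" and g: "\<gamma> \<in> \<Gamma>"
  shows "dist_to N \<Gamma> (d + \<gamma>) = dist_to N \<Gamma> d"
proof -
  have "(\<lambda>\<gamma>'. N (d + \<gamma> - \<gamma>')) ` \<Gamma> = (\<lambda>\<gamma>'. N (d - \<gamma>')) ` \<Gamma>"
  proof (intro equalityI subsetI)
    fix t assume "t \<in> (\<lambda>\<gamma>'. N (d + \<gamma> - \<gamma>')) ` \<Gamma>"
    then obtain h where "h \<in> \<Gamma>" "t = N (d - (h - \<gamma>))" by (auto simp: algebra_simps)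
    then show "t \<in> (\<lambda>\<gamma>'. N (d - \<gamma>')) ` \<Gamma>" using subspace_diff[OF \<Gamma> _ g] by blast
  next
    fix t assume "t \<in> (\<lambda>\<gamma>'. N (d - \<gamma>')) ` \<Gamma>"
    then obtain h where "h \<in> \<Gamma>" "t = N (d + \<gamma> - (h + \<gamma>))" by auto
    then show "t \<in> (\<lambda>\<gamma>'. N (d + \<gamma> - \<gamma>')) ` \<Gamma>" using subspace_add[OF \<Gamma> _ g] by blast
  qed
  then show ?thesis by (simp add: dist_to_def)
qed

text \<open>The distance is constant on cosets, so the quotient norm of a class can be read off any
  representative. This moves the argument from classes to vectors.\<close>

lemma quot_sphere_eq:
  assumes "subspace \<Gamma>"
  shows "quot_sphere N K \<Gamma> = coset \<Gamma> ` {d \<in> K. dist_to N \<Gamma> d = 1}"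
proof -
  have "quot_norm N \<Gamma> (coset \<Gamma> d) = dist_to N \<Gamma> d" for d
    unfolding quot_norm_def
    by (rule descend_coset[where f = "dist_to N \<Gamma>"]) (simp_all add: assms dist_to_add)
  then show ?thesis by (auto simp: quot_sphere_def quotient_space_def)
qed

section \<open>Positivity of the margin for an abstract detector\<close>

text \<open>Compactness gives one direction and normalisation the other. The conditions on
  \<open>M\<close> are nonnegativity, homogeneity, gauge invariance and sequential continuity, a
  form that admits a tax term for which no triangle inequality is known.\<close>

lemma comp_margin_pos_iff:
  assumes K: "subspace K" "fin_dim K" and N: "norm_on K N"
    and \<Gamma>: "subspace \<Gamma>" "\<Gamma> \<subseteq> K" "\<Gamma> \<noteq> K"
    and nonneg: "\<And>d. d \<in> K \<Longrightarrow> 0 \<le> M d"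
    and homogeneous: "\<And>c d. d \<in> K \<Longrightarrow> M (c *\<^sub>R d) = \<bar>c\<bar> * M d"
    and gauge: "\<And>d \<gamma>. d \<in> K \<Longrightarrow> \<gamma> \<in> \<Gamma> \<Longrightarrow> M (d + \<gamma>) = M d"
    and continuous: "\<And>x l. (\<And>n::nat. x n \<in> K) \<Longrightarrow> l \<in> K \<Longrightarrow> (\<lambda>n. N (x n - l)) \<longlonglongrightarrow> 0
      \<Longrightarrow> (\<lambda>n. M (x n)) \<longlonglongrightarrow> M l"
  shows "0 < comp_margin N K \<Gamma> M \<longleftrightarrow> (\<forall>d\<in>K. M d = 0 \<longrightarrow> d \<in> \<Gamma>)"
proof -
  \<comment> \<open>Used for \<open>\<Gamma>\<close>, to get positive distances, and for
    \<open>K\<close>, to extract the limit point.\<close>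
  have bw: "bolzano_weierstrass_on V N" if V: "subspace V" "V \<subseteq> K" for V
  proof -
    obtain B where "finite B" "span B = V"
      using subspace_fin_dim_mono[OF K(2) V] by (auto simp: fin_dim_def)
    then show ?thesis
      using bolzano_weierstrass_on_span[of B N] norm_on_subset[OF N V(2)] by simp
  qed
  define S where "S = {d \<in> K. dist_to N \<Gamma> d = 1}"
  have margin: "comp_margin N K \<Gamma> M = (INF d\<in>S. M d)"
  proof -
    have "descend M (coset \<Gamma> d) = M d" if "d \<in> S" for d
      using that by (intro descend_coset[OF \<Gamma>(1)] gauge) (auto simp: S_def)
    then have "(\<lambda>d. descend M (coset \<Gamma> d)) ` S = M ` S" by (rule image_cong[OF refl])
    then show ?thesis
      by (simp add: comp_margin_def quot_sphere_eq[OF \<Gamma>(1)] image_image S_def)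
  qed
  \<comment> \<open>The gap makes the distance to \<open>\<Gamma>\<close> positive, and its
    reciprocal is the factor \<open>c\<close>.\<close>
  have normalize: "\<exists>c. c *\<^sub>R d \<in> S" if d: "d \<in> K" "d \<notin> \<Gamma>" for d
  proof -
    obtain \<delta> where \<delta>: "0 < \<delta>" "\<forall>y\<in>\<Gamma>. \<delta> \<le> N (d - y)"
      using bolzano_weierstrass_on_gap[OF bw[OF \<Gamma>(1,2)] N K(1) \<Gamma>(2) d] by blast
    have pos: "0 < dist_to N \<Gamma> d" using dist_to_ge[OF \<Gamma>(1), of \<delta> N d] \<delta> by auto
    then have "dist_to N \<Gamma> ((1 / dist_to N \<Gamma> d) *\<^sub>R d) = 1"
      using dist_to_scaleR[OF N K(1) \<Gamma>(1,2) d(1), of "1 / dist_to N \<Gamma> d"] by simp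
    then show ?thesis using subspace_scale[OF K(1) d(1)] by (auto simp: S_def)
  qed
  \<comment> \<open>Nontriviality of the quotient enters here: it makes \<open>S\<close> nonempty,
    so the infimum over \<open>S\<close> is a genuine one.\<close>
  obtain d1 where "d1 \<in> K" "d1 \<notin> \<Gamma>" using \<Gamma>(2,3) by blast
  then have S_ne: "S \<noteq> {}" using normalize by blast
  have bdd: "bdd_below (M ` S)" using nonneg by (intro bdd_belowI2[of _ 0]) (auto simp: S_def)
  show ?thesis
    unfolding margin
  proof
    assume pos: "0 < (INF d\<in>S. M d)"
    show "\<forall>d\<in>K. M d = 0 \<longrightarrow> d \<in> \<Gamma>"
    proof (intro ballI impI, rule ccontr)
      fix d assume d: "d \<in> K" "M d = 0" "d \<notin> \<Gamma>"
      then obtain c where c: "c *\<^sub>R d \<in> S" using normalize by blast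
      have "(INF d\<in>S. M d) \<le> M (c *\<^sub>R d)" by (rule cINF_lower[OF bdd c])
      then show False using pos homogeneous[OF d(1)] d(2) by simp
    qed
  next
    assume kernel: "\<forall>d\<in>K. M d = 0 \<longrightarrow> d \<in> \<Gamma>"
    show "0 < (INF d\<in>S. M d)"
    proof (rule ccontr)
      assume "\<not> 0 < (INF d\<in>S. M d)"
      then have small: "\<exists>d\<in>S. M d < \<epsilon>" if "0 < \<epsilon>" for \<epsilon>
        using cINF_less_iff[OF S_ne bdd, of \<epsilon>] that by simp
      \<comment> \<open>Every class on the sphere has a representative of norm below 2, which makes the
        minimising sequence bounded.\<close>
      have "\<exists>d\<in>S. N d \<le> 2 \<and> M d < 1 / real (Suc n)" for n
      proof -
        obtain d where d: "d \<in> S" "M d < 1 / real (Suc n)" using small[of "1 / real (Suc n)"] by auto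
        then have dK: "d \<in> K" and d1: "dist_to N \<Gamma> d = 1" by (auto simp: S_def)
        \<comment> \<open>The infimum 1 need not be known to be attained; any number above 1 leaves
          room for a suitable \<open>g\<close>.\<close>
        have "\<not> 2 \<le> dist_to N \<Gamma> d" using d1 by simp
        then obtain g where g: "g \<in> \<Gamma>" "N (d - g) < 2"
          using dist_to_ge[OF \<Gamma>(1), of 2 N d] by (meson not_le)
        have g': "- g \<in> \<Gamma>" by (rule subspace_neg[OF \<Gamma>(1) g(1)])
        have "d - g \<in> S" "M (d - g) = M d"
          using dist_to_add[OF \<Gamma>(1) g', of N d] gauge[OF dK g'] d1
            subspace_diff[OF K(1) dK, of g] g(1) \<Gamma>(2) by (auto simp: S_def)
        then show ?thesis using g(2) d(2) by (intro bexI[of _ "d - g"]) auto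
      qed
      then obtain x where x: "\<And>n. x n \<in> S" "\<And>n. N (x n) \<le> 2" "\<And>n. M (x n) < 1 / real (Suc n)"
        by metis
      have xK: "x n \<in> K" and x1: "dist_to N \<Gamma> (x n) = 1" for n using x(1) by (auto simp: S_def)
      obtain l r where l: "l \<in> K" and r: "strict_mono r" and lim: "(\<lambda>n. N (x (r n) - l)) \<longlonglongrightarrow> 0"
        by (rule bolzano_weierstrass_onE[where x = x, OF bw[OF K(1) order.refl] xK x(2)])
      have "(\<lambda>n. M (x (r n))) \<longlonglongrightarrow> M l"
        by (rule continuous[OF xK l lim])
      moreover have "(\<lambda>n. M (x (r n))) \<longlonglongrightarrow> 0"
      proof (rule real_tendsto_sandwich[OF _ _ tendsto_const])
        show "(\<lambda>n. 1 / real (Suc (r n))) \<longlonglongrightarrow> 0"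
          using LIMSEQ_subseq_LIMSEQ[OF lim_1_over_n[THEN LIMSEQ_Suc] r] by (simp add: o_def)
      qed (use nonneg xK x(3) in \<open>auto intro!: always_eventually less_imp_le\<close>)
      ultimately have "M l = 0" by (rule LIMSEQ_unique)
      then have "l \<in> \<Gamma>" using kernel l by blast
      \<comment> \<open>As a point of \<open>\<Gamma>\<close>, the limit \<open>l\<close> competes
        in the infimum that equals 1, which keeps the sequence away from its own limit.\<close>
      then have "1 \<le> N (x (r n) - l)" for n
        using dist_to_le[OF N K(1) \<Gamma>(2) xK] x1 by metis
      then have "1 \<le> (0::real)" by (intro LIMSEQ_le_const[OF lim]) auto
      then show False by simp
    qed
  qed
qed

subsection \<open>Continuity of the detector\<close>

lemma seminorm_on_diff_le:
  assumes p: "seminorm_on V p" and V: "subspace V" and xy: "x \<in> V" "y \<in> V"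
  shows "\<bar>p x - p y\<bar> \<le> p (x - y)"
proof -
  have d: "x - y \<in> V" "y - x \<in> V" using subspace_diff[OF V] xy by auto
  have "p x \<le> p (x - y) + p y" "p y \<le> p (y - x) + p x"
    using p d xy unfolding seminorm_on_def by (metis diff_add_cancel)+
  moreover have "p ((- 1) *\<^sub>R (x - y)) = \<bar>- 1\<bar> * p (x - y)"
    using p d(1) unfolding seminorm_on_def by blast
  ultimately show ?thesis by simp
qed

text \<open>The reverse triangle inequality and the bound of \<open>p\<close> by a multiple of
  \<open>N\<close> make \<open>p\<close> Lipschitz for \<open>N\<close>.\<close>

lemma seminorm_on_tendsto:
  assumes p: "seminorm_on V p" and V: "subspace V" "fin_dim V" and N: "norm_on V N"
    and x: "\<And>n::nat. x n \<in> V" "l \<in> V" and lim: "(\<lambda>n. N (x n - l)) \<longlonglongrightarrow> 0"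
  shows "(\<lambda>n. p (x n)) \<longlonglongrightarrow> p l"
proof -
  obtain B where B: "finite B" "span B = V" using V(2) by (auto simp: fin_dim_def)
  then obtain C where C: "\<And>x. x \<in> V \<Longrightarrow> p x \<le> C * N x"
    using seminorm_on_span_bound[of B N p] N p by auto
  have "norm (p (x n) - p l) \<le> C * N (x n - l)" for n
    unfolding real_norm_def
    using seminorm_on_diff_le[OF p V(1) x] C[OF subspace_diff[OF V(1) x]] by (rule order.trans)
  then have "(\<lambda>n. p (x n) - p l) \<longlonglongrightarrow> 0"
    by (intro Lim_null_comparison[OF always_eventually tendsto_mult_right_zero[OF lim]] allI)
  then show ?thesis by (simp add: LIM_zero_iff)
qed

text \<open>Turns continuity for the metric topology of the carrier into the sequential form that
  the compactness argument consumes.\<close>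

lemma continuous_map_norm_dist_tendsto:
  assumes V: "subspace V" and N: "norm_on V N"
    and f: "continuous_map (Metric_space.mtopology V (norm_dist V N)) euclideanreal f"
    and x: "\<And>n::nat. x n \<in> V" "l \<in> V" and lim: "(\<lambda>n. N (x n - l)) \<longlonglongrightarrow> 0"
  shows "(\<lambda>n. f (x n)) \<longlonglongrightarrow> f l"
proof -
  interpret Metric_space V "norm_dist V N" by (rule Metric_space_norm_dist[OF V N])
  \<comment> \<open>All points lie in \<open>V\<close>, so the default value of
    \<open>norm_dist\<close> does not occur.\<close>
  have "norm_dist V N (x n) l = N (x n - l)" for n
    using subspace_diff[OF V x] by (simp add: norm_dist_def)
  then have "limitin mtopology x l sequentially"
    using x lim by (simp add: limitin_metric_dist_null)
  from continuous_map_limit[OF f this] show ?thesis by (simp add: o_def)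
qed

section \<open>The reproduction term as a seminorm\<close>

lemma Rep_eq_L2_set: "Rep \<Lambda> ND R d = L2_set (\<lambda>k. ND (k + 1) (d (k + 1) - R k (d k))) (adj \<Lambda>)"
  by (simp add: Rep_def L2_set_def)

text \<open>Each defect is linear in the family, and the Euclidean combination of the norms of the
  defects is subadditive by Minkowski's inequality, available through \<open>L2_set\<close>.\<close>

lemma seminorm_on_Rep:
  assumes D: "\<And>k. k \<in> \<Lambda> \<Longrightarrow> subspace (D k) \<and> norm_on (D k) (ND k)"
    and R: "\<And>k. k \<in> adj \<Lambda> \<Longrightarrow> linear_between (D k) (D (k + 1)) (R k)"
  shows "seminorm_on (prod_space \<Lambda> D) (Rep \<Lambda> ND R)"
proof -
  define u where "u d k = d (k + 1) - R k (d k)" for d :: "int \<Rightarrow> 'a" and k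
  have Rep: "Rep \<Lambda> ND R d = L2_set (\<lambda>k. ND (k + 1) (u d k)) (adj \<Lambda>)" for d
    by (simp add: Rep_eq_L2_set u_def)
  have adjD: "k \<in> \<Lambda>" "k + 1 \<in> \<Lambda>" if "k \<in> adj \<Lambda>" for k using that by (auto simp: adj_def)
  have comp: "d k \<in> D k" if "d \<in> prod_space \<Lambda> D" "k \<in> \<Lambda>" for d k
    using that by (simp add: prod_space_def)
  have u_in: "u d k \<in> D (k + 1)" if "d \<in> prod_space \<Lambda> D" "k \<in> adj \<Lambda>" for d k
    using comp[OF that(1)] adjD[OF that(2)] R[OF that(2)] D
    unfolding u_def linear_between_def by (meson image_subset_iff subspace_diff)
  have ND: "norm_on (D (k + 1)) (ND (k + 1))" if "k \<in> adj \<Lambda>" for k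
    using D adjD[OF that] by blast
  have u_add: "u (x + y) k = u x k + u y k"
    if "x \<in> prod_space \<Lambda> D" "y \<in> prod_space \<Lambda> D" "k \<in> adj \<Lambda>" for x y k
    using R[OF that(3)] comp adjD[OF that(3)] that by (simp add: u_def linear_between_def)
  have u_scale: "u (c *\<^sub>R x) k = c *\<^sub>R u x k"
    if "x \<in> prod_space \<Lambda> D" "k \<in> adj \<Lambda>" for x c k
    using R[OF that(2)] comp adjD[OF that(2)] that
    by (simp add: u_def linear_between_def scaleR_fun_def scaleR_diff_right)
  show ?thesis
    unfolding seminorm_on_def
  proof (intro conjI ballI allI)
    fix x y assume xy: "x \<in> prod_space \<Lambda> D" "y \<in> prod_space \<Lambda> D"
    have "Rep \<Lambda> ND R (x + y) \<le> L2_set (\<lambda>k. ND (k + 1) (u x k) + ND (k + 1) (u y k)) (adj \<Lambda>)"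
      unfolding Rep
      using norm_on_triangle[OF ND u_in[OF xy(1)] u_in[OF xy(2)]] u_add[OF xy]
        norm_on_nonneg[OF ND subspace_add[OF _ u_in[OF xy(1)] u_in[OF xy(2)]]] D adjD
      by (intro L2_set_mono) auto
    also have "\<dots> \<le> Rep \<Lambda> ND R x + Rep \<Lambda> ND R y"
      unfolding Rep by (rule L2_set_triangle_ineq)
    finally show "Rep \<Lambda> ND R (x + y) \<le> Rep \<Lambda> ND R x + Rep \<Lambda> ND R y" .
  next
    fix c x assume x: "x \<in> prod_space \<Lambda> D"
    show "Rep \<Lambda> ND R (c *\<^sub>R x) = \<bar>c\<bar> * Rep \<Lambda> ND R x"
      unfolding Rep using u_scale[OF x] norm_on_scaleR[OF ND u_in[OF x]]
      by (simp add: L2_set_right_distrib cong: L2_set_cong)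
  qed (simp add: Rep)
qed

section \<open>The equivalence for the composite detector\<close>

theorem theorem5p3:
  fixes k0 :: int and L :: nat and \<Lambda> :: "int set"
    and D :: "int \<Rightarrow> 'd::real_vector set"
    and ND :: "int \<Rightarrow> 'd \<Rightarrow> real"
    and N :: "(int \<Rightarrow> 'd) \<Rightarrow> real"
    and K \<Gamma> :: "(int \<Rightarrow> 'd) set"
    and G :: "'c::real_normed_vector \<Rightarrow> int \<Rightarrow> 'd"
    and OP :: "(int \<Rightarrow> 'd) \<Rightarrow> 'p::real_normed_vector"
    and OF :: "(int \<Rightarrow> 'd) \<Rightarrow> 'f::real_normed_vector"
    and OE :: "(int \<Rightarrow> 'd) \<Rightarrow> 'e::real_normed_vector"
    and OT :: "(int \<Rightarrow> 'd) \<Rightarrow> 't::real_normed_vector"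
    and NY :: "'p \<times> 'f \<times> 'e \<times> 't \<Rightarrow> real"
    and R :: "int \<Rightarrow> 'd \<Rightarrow> 'd"
    and Tax :: "(int \<Rightarrow> 'd) \<Rightarrow> real"
    and CR CT :: real
  assumes Lambda: "\<Lambda> = {k0..k0 + int L}"
    and D_space: "\<And>k. k \<in> \<Lambda> \<Longrightarrow> subspace (D k) \<and> fin_dim (D k) \<and> norm_on (D k) (ND k)"
    and N_norm: "norm_on (prod_space \<Lambda> D) N"
    and K_subspace: "subspace K" "K \<subseteq> prod_space \<Lambda> D"
    and C_fin_dim: "fin_dim (UNIV :: 'c set)"
    and G_linear: "linear_between UNIV (prod_space \<Lambda> D) G"
    and Gamma: "\<Gamma> = K \<inter> range G"
    and Y_fin_dim: "fin_dim (UNIV :: 'p set)" "fin_dim (UNIV :: 'f set)"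
      "fin_dim (UNIV :: 'e set)" "fin_dim (UNIV :: 't set)"
    and NY_norm: "norm_on UNIV NY"
    and Obs_linear: "linear_between K UNIV (Obs OP OF OE OT)"
    and R_linear: "\<And>k. k \<in> adj \<Lambda> \<Longrightarrow> linear_between (D k) (D (k + 1)) (R k)"
    and Tax_nonneg: "\<And>d. d \<in> K \<Longrightarrow> 0 \<le> Tax d"
    and Tax_continuous:
      "continuous_map (Metric_space.mtopology K (norm_dist K N)) euclideanreal Tax"
    and Tax_homogeneous: "\<And>c d. d \<in> K \<Longrightarrow> Tax (c *\<^sub>R d) = \<bar>c\<bar> * Tax d"
    and constants: "0 < CR" "0 < CT"
    and Q_nonzero: "quotient_space K \<Gamma> \<noteq> {coset \<Gamma> 0}"
    and gauge_Obs: "\<And>d \<gamma>. d \<in> K \<Longrightarrow> \<gamma> \<in> \<Gamma> \<Longrightarrow> Obs OP OF OE OT (d + \<gamma>) = Obs OP OF OE OT d"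
    and gauge_Rep: "\<And>d \<gamma>. d \<in> K \<Longrightarrow> \<gamma> \<in> \<Gamma> \<Longrightarrow> Rep \<Lambda> ND R (d + \<gamma>) = Rep \<Lambda> ND R d"
    and gauge_Tax: "\<And>d \<gamma>. d \<in> K \<Longrightarrow> \<gamma> \<in> \<Gamma> \<Longrightarrow> Tax (d + \<gamma>) = Tax d"
  shows "0 < comp_margin N K \<Gamma>
             (comp_detector NY CR CT (Obs OP OF OE OT) (Rep \<Lambda> ND R) Tax)
     \<longleftrightarrow> (\<forall>d\<in>K. Obs OP OF OE OT d = 0 \<and> Rep \<Lambda> ND R d = 0 \<and> Tax d = 0 \<longrightarrow> d \<in> \<Gamma>)"
proof -
  let ?O = "Obs OP OF OE OT" and ?Rep = "Rep \<Lambda> ND R"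
  let ?M = "comp_detector NY CR CT ?O ?Rep Tax"
  have K: "subspace K" by (rule K_subspace(1))
  have N: "norm_on K N" by (rule norm_on_subset[OF N_norm K_subspace(2)])
  have K_fin: "fin_dim K"
    using subspace_fin_dim_mono[OF fin_dim_prod_space K_subspace] D_space by (simp add: Lambda)
  have "subspace (range G)"
    using G_linear by (intro linear_subspace_image linearI) (auto simp: linear_between_def)
  then have \<Gamma>: "subspace \<Gamma>" "\<Gamma> \<subseteq> K" using K by (auto simp: Gamma subspace_inter)
  have "\<Gamma> \<noteq> K"
  proof
    assume "\<Gamma> = K"
    \<comment> \<open>If \<open>\<Gamma>\<close> were all of \<open>K\<close>, every class would be
      the zero class.\<close>
    have "coset \<Gamma> d = \<Gamma>" if "d \<in> \<Gamma>" for d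
    proof (intro equalityI subsetI)
      fix y assume "y \<in> coset \<Gamma> d"
      then show "y \<in> \<Gamma>" using subspace_add[OF \<Gamma>(1) that] by (auto simp: coset_def)
    next
      fix y assume "y \<in> \<Gamma>"
      then have "y - d \<in> \<Gamma>" "y = d + (y - d)" using subspace_diff[OF \<Gamma>(1) _ that] by auto
      then show "y \<in> coset \<Gamma> d" unfolding coset_def by blast
    qed
    then have "quotient_space K \<Gamma> = {coset \<Gamma> 0}"
      using \<open>\<Gamma> = K\<close> subspace_0[OF K] by (force simp: quotient_space_def)
    with Q_nonzero show False by contradiction
  qed
  have Rep: "seminorm_on K ?Rep"
    using D_space R_linear by (intro seminorm_on_subset[OF seminorm_on_Rep K_subspace(2)]) auto
  \<comment> \<open>Observation and reproduction are subadditive, so their continuity follows from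
    finite dimension. The tax is kept apart: its continuity is a hypothesis.\<close>
  define p where "p d = NY (?O d) + CR * ?Rep d" for d
  have O_add: "?O (x + y) = ?O x + ?O y" if "x \<in> K" "y \<in> K" for x y
    using Obs_linear that unfolding linear_between_def by blast
  have O_scale: "?O (c *\<^sub>R x) = c *\<^sub>R ?O x" if "x \<in> K" for c x
    using Obs_linear that unfolding linear_between_def by blast
  have p: "seminorm_on K p"
    unfolding seminorm_on_def
  proof (intro conjI ballI allI)
    fix x assume x: "x \<in> K"
    have Rx: "0 \<le> ?Rep x" using Rep x by (simp add: seminorm_on_def)
    then show "0 \<le> p x"
      using norm_on_nonneg[OF NY_norm] constants by (simp add: p_def)
    show "p (x + y) \<le> p x + p y" if y: "y \<in> K" for y
    proof -
      have "?Rep (x + y) \<le> ?Rep x + ?Rep y" using Rep x y by (simp add: seminorm_on_def)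
      from mult_left_mono[OF this, of CR] show ?thesis
        using norm_on_triangle[OF NY_norm, of "?O x" "?O y"] constants O_add[OF x y]
        by (simp add: p_def algebra_simps)
    qed
    show "p (c *\<^sub>R x) = \<bar>c\<bar> * p x" for c
      using Rep x norm_on_scaleR[OF NY_norm, of "?O x" c] O_scale[OF x]
      by (simp add: p_def seminorm_on_def algebra_simps)
  qed
  have M: "?M d = p d + CT * Tax d" for d by (simp add: comp_detector_def p_def)
  have "0 < comp_margin N K \<Gamma> ?M \<longleftrightarrow> (\<forall>d\<in>K. ?M d = 0 \<longrightarrow> d \<in> \<Gamma>)"
  proof (rule comp_margin_pos_iff[OF K K_fin N \<Gamma> \<open>\<Gamma> \<noteq> K\<close>])
    show "0 \<le> ?M d" if "d \<in> K" for d
      using p that Tax_nonneg[OF that] constants by (simp add: M seminorm_on_def)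
    show "?M (c *\<^sub>R d) = \<bar>c\<bar> * ?M d" if "d \<in> K" for c d
      using p that Tax_homogeneous[OF that] by (simp add: M seminorm_on_def algebra_simps)
    show "?M (d + \<gamma>) = ?M d" if "d \<in> K" "\<gamma> \<in> \<Gamma>" for d \<gamma>
      using gauge_Obs[OF that] gauge_Rep[OF that] gauge_Tax[OF that]
      by (simp add: comp_detector_def)
    show "(\<lambda>n. ?M (x n)) \<longlonglongrightarrow> ?M l"
      if x: "\<And>n::nat. x n \<in> K" "l \<in> K" "(\<lambda>n. N (x n - l)) \<longlonglongrightarrow> 0" for x l
      unfolding M
    proof (intro tendsto_intros)
      show "(\<lambda>n. p (x n)) \<longlonglongrightarrow> p l"
        by (rule seminorm_on_tendsto[where x = x, OF p K K_fin N x])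
      show "(\<lambda>n. Tax (x n)) \<longlonglongrightarrow> Tax l"
        by (rule continuous_map_norm_dist_tendsto[where x = x, OF K N Tax_continuous x])
    qed
  qed
  \<comment> \<open>A sum of three nonnegative terms vanishes only if each does; positivity of the
    weights and definiteness of \<open>NY\<close> then give the three kernel conditions.\<close>
  moreover have "?M d = 0 \<longleftrightarrow> ?O d = 0 \<and> ?Rep d = 0 \<and> Tax d = 0" if d: "d \<in> K" for d
  proof -
    have "0 \<le> NY (?O d)" "NY (?O d) = 0 \<longleftrightarrow> ?O d = 0"
      using norm_on_D[OF NY_norm] by auto
    moreover have "0 \<le> CR * ?Rep d" "0 \<le> CT * Tax d"
      using Rep d Tax_nonneg[OF d] constants by (auto simp: seminorm_on_def)
    ultimately show ?thesis using constants by (auto simp: comp_detector_def add_nonneg_eq_0_iff)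
  qed
  ultimately show ?thesis by auto
qed

end
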